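(* Let $L\ge 1$, let $d_1,\dots,d_L\ge 1$ be integers with $d_L=d$, and let $w=(w_{j_1},w_{j_1,j_2},\dots,w_{j_{L-1},j_L})$ be arbitrary real weights of an $L$-layer ReLU network, with $1\le j_\ell\le d_\ell$ for each $\ell$. Let $\phi_{out}:\mathbb{R}\to\mathbb{R}$ be any fixed output function (for instance the identity, or a Lipschitz-$1$ function), and let $$f(w,x)=\phi_{out}\Big(\sum_{j_1=1}^{d_1} w_{j_1}\Big(\sum_{j_2=1}^{d_2} w_{j_1,j_2}\cdots\Big(\sum_{j_L=1}^{d_L} w_{j_{L-1},j_L}\,x_{j_L}\Big)_+\cdots\Big)_+\Big),\qquad x\in[-1,1]^d,$$ be the function it represents. Let $$V=\sum_{j_1,\dots,j_L}|w_{j_1}|\,|w_{j_1,j_2}|\cdots|w_{j_{L-1},j_L}|$$ be the total variation of the path weights. Then $f(w,\cdot)$ can be written as a network with signed duplicates of its units, with non-negative weights summing to exactly $1$ over the inputs to each unit, and with the original inputs all multiplied by $V$. That is, there exist non-negative numbers $a_{j_1}$ ($1\le j_1\le 2d_1$) and $a_{j_\ell\mid j_{\ell-1}}$ ($2\le \ell\le L$, $1\le j_{\ell-1}\le 2d_{\ell-1}$, $1\le j_\ell\le 2d_\ell$) with $$\sum_{j_1=1}^{2d_1}a_{j_1}=1,\qquad \sum_{j_\ell=1}^{2d_\ell}a_{j_\ell\mid j_{\ell-1}}=1\ \text{ for all } \ell \text{ and all } j_{\ell-1},$$ such that for all $x\in[-1,1]^d$ $$f(w,x)=\phi_{out}\Big(\sum_{j_1=1}^{2d_1}a_{j_1}\,\phi_{j_1}\Big(\sum_{j_2=1}^{2d_2}a_{j_2\mid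 j_1}\cdots\phi_{j_{L-1}}\Big(\sum_{j_L=1}^{2d}a_{j_L\mid j_{L-1}}\,V x_{j_L}\Big)\cdots\Big)\Big).$$
   Context: Here $(z)_+=\max\{z,0\}$ is the ReLU. Layer index $\ell=1$ is the outermost layer and $\ell=L$ is the innermost (input) layer; for $L=1$ the network is $\phi_{out}(\sum_{j_1}w_{j_1}x_{j_1})$. In the duplicated network, the inputs are extended by opposite-sign duplicates, $x_{d+j}=-x_j$ for $1\le j\le d$. For $1\le \ell\le L-1$ the activation attached to unit $j_\ell$ is $\phi_{j_\ell}(z)=(z)_+$ if $1\le j_\ell\le d_\ell$ and $\phi_{j_\ell}(z)=-(z)_+$ if $d_\ell<j_\ell\le 2d_\ell$. Offsets (biases) are included in this framework by allowing one input coordinate to be locked at the value $1$ and allowing in each layer a unit whose input weights are concentrated on the locked unit of the next more inward layer. *)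

theory Defs
  imports Complex_Main "HOL-Library.FuncSet"
begin

text \<open>
  Layers and units are numbered from 1; layer 1 is the outermost layer and layer L the input
  layer. Layer l has n l units. The weight attached to unit j of layer 1 is v j, and for
  2 \<le> l \<le> L the weight from unit j of layer l into unit i of layer l - 1 is W l i j.
  Only values at indices within these ranges matter. For l < L, unit_out L n act W x l i is the
  output of unit i of layer l after its activation act l i has been applied; layer L passes the
  inputs x on unchanged.
\<close>

definition relu :: "real \<Rightarrow> real" where
  "relu z = max z 0"

function unit_out ::
  "nat \<Rightarrow> (nat \<Rightarrow> nat) \<Rightarrow> (nat \<Rightarrow> nat \<Rightarrow> real \<Rightarrow> real) \<Rightarrow>
   (nat \<Rightarrow> nat \<Rightarrow> nat \<Rightarrow> real) \<Rightarrow> (nat \<Rightarrow> real) \<Rightarrow> nat \<Rightarrow> nat \<Rightarrow> real" where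
  "unit_out L n act W x l i =
     (if L \<le> l then x i
      else act l i (\<Sum>j = 1..n (Suc l). W (Suc l) i j * unit_out L n act W x (Suc l) j))"
  by pat_completeness auto
termination
  by (relation "measure (\<lambda>(L, n, act, W, x, l, i). L - l)") auto

declare unit_out.simps [simp del]

definition network ::
  "nat \<Rightarrow> (nat \<Rightarrow> nat) \<Rightarrow> (nat \<Rightarrow> nat \<Rightarrow> real \<Rightarrow> real) \<Rightarrow> (real \<Rightarrow> real) \<Rightarrow>
   (nat \<Rightarrow> real) \<Rightarrow> (nat \<Rightarrow> nat \<Rightarrow> nat \<Rightarrow> real) \<Rightarrow> (nat \<Rightarrow> real) \<Rightarrow> real" where
  "network L n act \<phi>out v W x = \<phi>out (\<Sum>j = 1..n 1. v j * unit_out L n act W x 1 j)"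

definition relu_network ::
  "nat \<Rightarrow> (nat \<Rightarrow> nat) \<Rightarrow> (real \<Rightarrow> real) \<Rightarrow>
   (nat \<Rightarrow> real) \<Rightarrow> (nat \<Rightarrow> nat \<Rightarrow> nat \<Rightarrow> real) \<Rightarrow> (nat \<Rightarrow> real) \<Rightarrow> real" where
  "relu_network L d = network L d (\<lambda>l j. relu)"

text \<open>
  The network with signed duplicates: units d l + 1, \<dots>, 2 * d l of a hidden layer l carry the
  negated activation. The network reads 2 * d L inputs; those obtained from m = d L original
  inputs x are signed_input m x, that is, x extended by x (m + j) = - x j.
\<close>

definition signed_relu :: "(nat \<Rightarrow> nat) \<Rightarrow> nat \<Rightarrow> nat \<Rightarrow> real \<Rightarrow> real" where
  "signed_relu d l j z = (if j \<le> d l then relu z else - relu z)"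

definition signed_input :: "nat \<Rightarrow> (nat \<Rightarrow> real) \<Rightarrow> nat \<Rightarrow> real" where
  "signed_input m x j = (if j \<le> m then x j else - x (j - m))"

definition signed_network ::
  "nat \<Rightarrow> (nat \<Rightarrow> nat) \<Rightarrow> (real \<Rightarrow> real) \<Rightarrow>
   (nat \<Rightarrow> real) \<Rightarrow> (nat \<Rightarrow> nat \<Rightarrow> nat \<Rightarrow> real) \<Rightarrow> (nat \<Rightarrow> real) \<Rightarrow> real" where
  "signed_network L d \<phi>out a A x =
     network L (\<lambda>l. 2 * d l) (signed_relu d) \<phi>out a A x"

text \<open>A path (j 1, \<dots>, j L) is an extensional function on {1..L}.\<close>

definition path_variation ::
  "nat \<Rightarrow> (nat \<Rightarrow> nat) \<Rightarrow> (nat \<Rightarrow> real) \<Rightarrow> (nat \<Rightarrow> nat \<Rightarrow> nat \<Rightarrow> real) \<Rightarrow> real" where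
  "path_variation L d v W =
     (\<Sum>j \<in> (\<Pi>\<^sub>E l \<in> {1..L}. {1..d l}). \<bar>v (j 1)\<bar> * (\<Prod>l = 2..L. \<bar>W l (j (l - 1)) (j l)\<bar>))"

end

theory Submission
  imports Defs
begin

text \<open>
  Let S(l, i) be the total variation of the path weights from unit i of layer l inwards to the
  inputs. Take the conditional weight from unit j of layer l to unit i of layer l - 1 to be
  the positive (for the duplicate, the negative) part of the original weight times
  S(l, j) / S(l - 1, i). Since relu is positively homogeneous, the output of each unit of the
  new network, on inputs multiplied by V, is the original output times V / S(l, i), up to the sign
  of the duplicate; at the output the factor is V / V = 1. Units with S(l, i) = 0 have output 0
  and receive uniform weights, whose contributions cancel between duplicates.
\<close>

section \<open>Path masses and the total variation\<close>

text \<open>This is S(l, i), obtained as the output of a linear network with absolute weights and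
  all inputs 1, so that it obeys the same layer recursion as the original network.\<close>

definition path_mass ::
  "nat \<Rightarrow> (nat \<Rightarrow> nat) \<Rightarrow> (nat \<Rightarrow> nat \<Rightarrow> nat \<Rightarrow> real) \<Rightarrow> nat \<Rightarrow> nat \<Rightarrow> real" where
  "path_mass L d W = unit_out L d (\<lambda>_ _ z. z) (\<lambda>l i j. \<bar>W l i j\<bar>) (\<lambda>_. 1)"

lemma path_mass_input: "L \<le> l \<Longrightarrow> path_mass L d W l i = 1"
  by (simp add: path_mass_def unit_out.simps)

lemma path_mass_step:
  "l < L \<Longrightarrow> path_mass L d W l i =
     (\<Sum>j = 1..d (Suc l). \<bar>W (Suc l) i j\<bar> * path_mass L d W (Suc l) j)"
  by (simp add: path_mass_def unit_out.simps[of L _ _ _ _ l])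

lemma path_mass_nonneg: "0 \<le> path_mass L d W l i"
proof (induction "L - l" arbitrary: l i)
  case 0
  then show ?case by (simp add: path_mass_input)
next
  case (Suc k)
  then have "l < L" and "k = L - Suc l" by auto
  then show ?case using Suc.hyps(1)[of "Suc l"]
    by (simp add: path_mass_step sum_nonneg)
qed

lemma sum_PiE_insert:
  assumes "l \<notin> A"
  shows "(\<Sum>f \<in> PiE (insert l A) B. h f) = (\<Sum>i \<in> B l. \<Sum>f \<in> PiE A B. h (f(l := i)))"
proof -
  have "(\<Sum>f \<in> PiE (insert l A) B. h f) = (\<Sum>(i, f) \<in> B l \<times> PiE A B. h (f(l := i)))"
    unfolding PiE_insert_eq using inj_combinator[OF assms, of B]
    by (subst sum.reindex) (auto simp: case_prod_unfold)
  then show ?thesis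
    by (simp add: sum.cartesian_product)
qed

text \<open>Distributivity, one layer at a time. The factor \<open>g\<close> is arbitrary so that
  the induction closes: splitting off unit \<open>i\<close> of layer \<open>l\<close> leaves the
  same kind of sum, with the absolute weights into \<open>i\<close> in place of
  \<open>g\<close>.\<close>

lemma sum_paths_eq_path_mass:
  assumes "l \<le> L"
  shows "(\<Sum>j \<in> (\<Pi>\<^sub>E k \<in> {l..L}. {1..d k}).
            g (j l) * (\<Prod>k = Suc l..L. \<bar>W k (j (k - 1)) (j k)\<bar>)) =
         (\<Sum>i = 1..d l. g i * path_mass L d W l i)"
  using assms
proof (induction "L - l" arbitrary: l g)
  case 0
  then have "l = L" by simp
  then show ?case
    using sum_PiE_insert[of L "{}" "\<lambda>j. g (j L)" "\<lambda>k. {1..d k}"]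
    by (simp add: path_mass_input)
next
  case (Suc n)
  then have "l < L" by simp
  have ins: "{l..L} = insert l {Suc l..L}" using \<open>l < L\<close> by auto
  \<comment> \<open>Only the factor at \<open>Suc l\<close> looks at position \<open>l\<close> of
    the path; all later factors are unaffected by the update.\<close>
  have prod_upd: "(\<Prod>k = Suc l..L. \<bar>W k ((j(l := i)) (k - 1)) ((j(l := i)) k)\<bar>) =
      \<bar>W (Suc l) i (j (Suc l))\<bar> * (\<Prod>k = Suc (Suc l)..L. \<bar>W k (j (k - 1)) (j k)\<bar>)"
    for i and j :: "nat \<Rightarrow> nat"
  proof -
    have "{Suc l..L} = insert (Suc l) {Suc (Suc l)..L}" using \<open>l < L\<close> by auto
    moreover have "(\<Prod>k = Suc (Suc l)..L. \<bar>W k ((j(l := i)) (k - 1)) ((j(l := i)) k)\<bar>) =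
        (\<Prod>k = Suc (Suc l)..L. \<bar>W k (j (k - 1)) (j k)\<bar>)"
      by (intro prod.cong) auto
    ultimately show ?thesis by simp
  qed
  have "(\<Sum>j \<in> (\<Pi>\<^sub>E k \<in> {l..L}. {1..d k}).
           g (j l) * (\<Prod>k = Suc l..L. \<bar>W k (j (k - 1)) (j k)\<bar>)) =
        (\<Sum>i = 1..d l. \<Sum>j \<in> (\<Pi>\<^sub>E k \<in> {Suc l..L}. {1..d k}). g i *
           (\<bar>W (Suc l) i (j (Suc l))\<bar> * (\<Prod>k = Suc (Suc l)..L. \<bar>W k (j (k - 1)) (j k)\<bar>)))"
    unfolding ins by (subst sum_PiE_insert) (simp_all only: prod_upd fun_upd_same, auto)
  also have "\<dots> = (\<Sum>i = 1..d l. g i *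
      (\<Sum>j = 1..d (Suc l). \<bar>W (Suc l) i j\<bar> * path_mass L d W (Suc l) j))"
    unfolding sum_distrib_left[symmetric]
    using Suc.hyps \<open>l < L\<close> by (subst Suc.hyps(1)) auto
  finally show ?case using \<open>l < L\<close> by (simp add: path_mass_step)
qed

lemma path_variation_eq:
  assumes "L \<ge> 1"
  shows "path_variation L d v W = (\<Sum>j = 1..d 1. \<bar>v j\<bar> * path_mass L d W 1 j)"
  using sum_paths_eq_path_mass[OF assms, of "\<lambda>i. \<bar>v i\<bar>" W d]
  by (simp add: path_variation_def numeral_2_eq_2)

text \<open>\<open>relu\<close> does not increase absolute values, so the triangle inequality
  propagates the bound 1 on the inputs outwards. The bound forces units of path mass 0 to output 0,
  which makes dividing by path masses harmless.\<close>

lemma abs_unit_out_relu_le_path_mass: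
  assumes "\<And>i. i \<in> {1..d L} \<Longrightarrow> \<bar>x i\<bar> \<le> 1" and "l \<le> L" and "i \<in> {1..d l}"
  shows "\<bar>unit_out L d (\<lambda>_ _. relu) W x l i\<bar> \<le> path_mass L d W l i"
  using assms(2,3)
proof (induction "L - l" arbitrary: l i)
  case 0
  then show ?case using assms(1) by (simp add: path_mass_input unit_out.simps)
next
  case (Suc k)
  let ?u = "unit_out L d (\<lambda>_ _. relu) W x"
  from Suc have "l < L" and "k = L - Suc l" by auto
  have "\<bar>?u l i\<bar> \<le> \<bar>\<Sum>j = 1..d (Suc l). W (Suc l) i j * ?u (Suc l) j\<bar>"
    using \<open>l < L\<close> by (simp add: unit_out.simps[of L _ _ _ _ l] relu_def)
  also have "\<dots> \<le> (\<Sum>j = 1..d (Suc l). \<bar>W (Suc l) i j * ?u (Suc l) j\<bar>)"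
    by (rule sum_abs)
  also have "\<dots> \<le> (\<Sum>j = 1..d (Suc l). \<bar>W (Suc l) i j\<bar> * path_mass L d W (Suc l) j)"
    unfolding abs_mult
    using Suc.hyps(1)[of "Suc l"] \<open>k = L - Suc l\<close> \<open>l < L\<close>
    by (intro sum_mono mult_left_mono) auto
  finally show ?case using \<open>l < L\<close> by (simp add: path_mass_step)
qed

section \<open>Weights into a single unit of the duplicated network\<close>

definition base_unit :: "nat \<Rightarrow> nat \<Rightarrow> nat" where
  "base_unit m j = (if j \<le> m then j else j - m)"

text \<open>Here \<open>c\<close> holds the original weights into one unit and \<open>s\<close> the
  path masses of the \<open>m\<close> units it reads, so \<open>t\<close> is the path mass of the
  receiving unit, or V at the output.\<close>

definition signed_weight ::
  "nat \<Rightarrow> (nat \<Rightarrow> real) \<Rightarrow> (nat \<Rightarrow> real) \<Rightarrow> nat \<Rightarrow> real" where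
  "signed_weight m c s j =
     (let t = \<Sum>k = 1..m. \<bar>c k\<bar> * s k in
      if t = 0 then 1 / (2 * real m)
      else (if j \<le> m then max (c j) 0 else max (- c (j - m)) 0) * s (base_unit m j) / t)"

lemma sum_double:
  fixes f :: "nat \<Rightarrow> 'a::comm_monoid_add"
  shows "(\<Sum>j = 1..2 * m. f j) = (\<Sum>j = 1..m. f j + f (m + j))"
proof -
  have "(\<Sum>j = 1..2 * m. f j) = (\<Sum>j = 1..m. f j) + (\<Sum>j = m + 1..m + m. f j)"
    using sum.ub_add_nat[of 1 m f m] by (simp add: mult_2)
  also have "(\<Sum>j = m + 1..m + m. f j) = (\<Sum>j = 1..m. f (m + j))"
    using sum.shift_bounds_cl_nat_ivl[of f 1 m m] by (simp add: add.commute)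
  finally show ?thesis by (simp add: sum.distrib)
qed

lemma signed_weight_nonneg:
  assumes "\<And>k. 0 \<le> s k"
  shows "0 \<le> signed_weight m c s j"
  using assms by (auto simp: signed_weight_def Let_def sum_nonneg)

lemma sum_signed_weight:
  assumes "m \<ge> 1"
  shows "(\<Sum>j = 1..2 * m. signed_weight m c s j) = 1"
proof -
  define t where "t = (\<Sum>k = 1..m. \<bar>c k\<bar> * s k)"
  have weight: "signed_weight m c s j =
      (if t = 0 then 1 / (2 * real m)
       else (if j \<le> m then max (c j) 0 else max (- c (j - m)) 0) * s (base_unit m j) / t)" for j
    by (simp add: signed_weight_def Let_def t_def)
  show ?thesis
  proof (cases "t = 0")
    case True
    then show ?thesis
      using assms by (simp add: weight)
  next
    case False
    \<comment> \<open>The positive and negative parts of \<open>c j\<close> add up to its absolute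
      value.\<close>
    have "signed_weight m c s j + signed_weight m c s (m + j) = \<bar>c j\<bar> * s j / t"
      if "j \<in> {1..m}" for j
      using that False
      by (auto simp: weight base_unit_def max_def)
    then have "(\<Sum>j = 1..2 * m. signed_weight m c s j) = (\<Sum>j = 1..m. \<bar>c j\<bar> * s j / t)"
      unfolding sum_double by (intro sum.cong) auto
    also have "\<dots> = 1"
      using False by (simp add: sum_divide_distrib[symmetric] t_def)
    finally show ?thesis .
  qed
qed

text \<open>For total mass 0 both sides vanish, the right-hand side by division by 0.\<close>

lemma sum_signed_weight_mult:
  assumes "\<And>j. j \<in> {1..m} \<Longrightarrow> u (m + j) = - u j"
  shows "(\<Sum>j = 1..2 * m. signed_weight m c s j * u j) =
         (\<Sum>j = 1..m. c j * s j * u j) / (\<Sum>k = 1..m. \<bar>c k\<bar> * s k)"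
proof -
  define t where "t = (\<Sum>k = 1..m. \<bar>c k\<bar> * s k)"
  have weight: "signed_weight m c s j =
      (if t = 0 then 1 / (2 * real m)
       else (if j \<le> m then max (c j) 0 else max (- c (j - m)) 0) * s (base_unit m j) / t)" for j
    by (simp add: signed_weight_def Let_def t_def)
  \<comment> \<open>The sign of the duplicate turns the sum of the two parts of \<open>c j\<close>
    into their difference, which is \<open>c j\<close>.\<close>
  have "signed_weight m c s j * u j + signed_weight m c s (m + j) * u (m + j) =
        c j * s j * u j / t" if "j \<in> {1..m}" for j
    using that assms[OF that]
    by (auto simp: weight base_unit_def max_def)
  then show ?thesis
    unfolding sum_double t_def[symmetric] sum_divide_distrib by (intro sum.cong) auto
qed

text \<open>The factor \<open>s j\<close> in the weight cancels the denominator of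
  \<open>u j\<close>. Where \<open>s j = 0\<close>, the last assumption makes both terms
  vanish.\<close>

lemma sum_signed_weight_rescaled:
  assumes "\<And>j. j \<in> {1..m} \<Longrightarrow> u (m + j) = - u j"
    and "\<And>j. j \<in> {1..m} \<Longrightarrow> u j = V * y j / s j"
    and "\<And>j. j \<in> {1..m} \<Longrightarrow> s j = 0 \<Longrightarrow> y j = 0"
  shows "(\<Sum>j = 1..2 * m. signed_weight m c s j * u j) =
         V * (\<Sum>j = 1..m. c j * y j) / (\<Sum>k = 1..m. \<bar>c k\<bar> * s k)"
proof -
  have "(\<Sum>j = 1..m. c j * s j * u j) = (\<Sum>j = 1..m. V * (c j * y j))"
    using assms(2,3) by (intro sum.cong) auto
  then show ?thesis
    using sum_signed_weight_mult[of m u c s, OF assms(1)] by (simp add: sum_distrib_left)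
qed

section \<open>Comparing the duplicated network with the original\<close>

definition layer_weight ::
  "nat \<Rightarrow> (nat \<Rightarrow> nat) \<Rightarrow> (nat \<Rightarrow> nat \<Rightarrow> nat \<Rightarrow> real) \<Rightarrow> nat \<Rightarrow> nat \<Rightarrow> nat \<Rightarrow> real" where
  "layer_weight L d W l i =
     signed_weight (d l) (W l (base_unit (d (l - 1)) i)) (path_mass L d W l)"

lemma relu_mult: "0 \<le> c \<Longrightarrow> relu (c * z) = c * relu z"
  by (simp add: relu_def max_mult_distrib_left)

abbreviation signed_out where
  "signed_out L d W V x \<equiv>
     unit_out L (\<lambda>l. 2 * d l) (signed_relu d) (layer_weight L d W)
       (\<lambda>j. V * signed_input (d L) x j)"

lemma signed_out_duplicate:
  assumes "l \<le> L" and "i \<in> {1..d l}"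
  shows "signed_out L d W V x l (d l + i) = - signed_out L d W V x l i"
proof (cases "l = L")
  case True
  then show ?thesis
    using assms by (simp add: unit_out.simps signed_input_def)
next
  case False
  then have "layer_weight L d W (Suc l) (d l + i) = layer_weight L d W (Suc l) i"
    using assms by (simp add: layer_weight_def base_unit_def)
  then show ?thesis
    using False assms by (simp add: unit_out.simps[of L _ _ _ _ l] signed_relu_def)
qed

lemma signed_out_eq:
  assumes "V \<ge> 0" and "\<And>i. i \<in> {1..d L} \<Longrightarrow> \<bar>x i\<bar> \<le> 1"
    and "l \<le> L" and "i \<in> {1..d l}"
  shows "signed_out L d W V x l i =
         V * unit_out L d (\<lambda>_ _. relu) W x l i / path_mass L d W l i"
  using assms(3,4)
proof (induction "L - l" arbitrary: l i)
  case 0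
  then show ?case by (simp add: path_mass_input unit_out.simps signed_input_def)
next
  case (Suc k)
  let ?u = "unit_out L d (\<lambda>_ _. relu) W x" and ?s = "path_mass L d W"
  let ?z = "\<Sum>j = 1..d (Suc l). W (Suc l) i j * ?u (Suc l) j"
  from Suc have "l < L" and k: "k = L - Suc l" by auto
  have zero: "?u (Suc l) j = 0" if "j \<in> {1..d (Suc l)}" and "?s (Suc l) j = 0" for j
    using abs_unit_out_relu_le_path_mass[of d L x "Suc l" j W] assms(2) \<open>l < L\<close> that by auto
  have "signed_out L d W V x l i =
      relu (\<Sum>j = 1..2 * d (Suc l). signed_weight (d (Suc l)) (W (Suc l) i) (?s (Suc l)) j *
              signed_out L d W V x (Suc l) j)"
    using \<open>l < L\<close> Suc.prems
    by (simp add: unit_out.simps[of L _ _ _ _ l] signed_relu_def layer_weight_def base_unit_def)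
  also have "\<dots> = relu (V * ?z / (\<Sum>j = 1..d (Suc l). \<bar>W (Suc l) i j\<bar> * ?s (Suc l) j))"
    using \<open>l < L\<close> k zero
    by (intro arg_cong[where f = relu] sum_signed_weight_rescaled signed_out_duplicate
        Suc.hyps(1)) auto
  \<comment> \<open>The normalizing sum is the path mass of unit \<open>i\<close>, and the factor
    pulled out is nonnegative, as homogeneity of \<open>relu\<close> requires.\<close>
  also have "\<dots> = relu (V / ?s l i * ?z)"
    using \<open>l < L\<close> by (simp add: path_mass_step)
  also have "\<dots> = V / ?s l i * relu ?z"
    using assms(1) path_mass_nonneg by (intro relu_mult) simp
  finally show ?case
    using \<open>l < L\<close> by (simp add: unit_out.simps[of L _ _ _ _ l])
qed

theorem theorem1:
  fixes L :: nat and d :: "nat \<Rightarrow> nat"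
    and w1 :: "nat \<Rightarrow> real" and w :: "nat \<Rightarrow> nat \<Rightarrow> nat \<Rightarrow> real"
    and \<phi>out :: "real \<Rightarrow> real"
  assumes "L \<ge> 1"
    and "\<And>l. l \<in> {1..L} \<Longrightarrow> d l \<ge> 1"
  shows "\<exists>(a1 :: nat \<Rightarrow> real) (a :: nat \<Rightarrow> nat \<Rightarrow> nat \<Rightarrow> real).
      (\<forall>j \<in> {1..2 * d 1}. 0 \<le> a1 j) \<and>
      (\<forall>l \<in> {2..L}. \<forall>i \<in> {1..2 * d (l - 1)}. \<forall>j \<in> {1..2 * d l}. 0 \<le> a l i j) \<and>
      (\<Sum>j = 1..2 * d 1. a1 j) = 1 \<and>
      (\<forall>l \<in> {2..L}. \<forall>i \<in> {1..2 * d (l - 1)}. (\<Sum>j = 1..2 * d l. a l i j) = 1) \<and>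
      (\<forall>x \<in> {1..d L} \<rightarrow> {-1..1}.
         relu_network L d \<phi>out w1 w x =
         signed_network L d \<phi>out a1 a
           (\<lambda>j. path_variation L d w1 w * signed_input (d L) x j))"
proof (intro exI conjI ballI)
  let ?a1 = "signed_weight (d 1) w1 (path_mass L d w 1)" and ?a = "layer_weight L d w"
  let ?V = "path_variation L d w1 w"
  show "0 \<le> ?a1 j" for j
    by (intro signed_weight_nonneg path_mass_nonneg)
  show "0 \<le> ?a l i j" for l i j
    unfolding layer_weight_def by (intro signed_weight_nonneg path_mass_nonneg)
  show "(\<Sum>j = 1..2 * d 1. ?a1 j) = 1"
    using assms by (intro sum_signed_weight) auto
  show "(\<Sum>j = 1..2 * d l. ?a l i j) = 1" if "l \<in> {2..L}" for l i
    unfolding layer_weight_def using assms(2) that by (intro sum_signed_weight) auto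
  fix x assume "x \<in> {1..d L} \<rightarrow> {-1..1::real}"
  then have x: "\<bar>x i\<bar> \<le> 1" if "i \<in> {1..d L}" for i
    using that by (force simp: abs_le_iff)
  let ?u = "unit_out L d (\<lambda>_ _. relu) w x 1" and ?s = "path_mass L d w 1"
  let ?z = "\<Sum>j = 1..d 1. w1 j * ?u j"
  have V: "?V = (\<Sum>j = 1..d 1. \<bar>w1 j\<bar> * ?s j)"
    using assms(1) by (rule path_variation_eq)
  then have "?V \<ge> 0"
    by (simp add: sum_nonneg path_mass_nonneg)
  have bound: "\<bar>?u j\<bar> \<le> ?s j" if "j \<in> {1..d 1}" for j
    using abs_unit_out_relu_le_path_mass[of d L x 1 j w] x assms(1) that by auto
  have "(\<Sum>j = 1..2 * d 1. ?a1 j * signed_out L d w ?V x 1 j) =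
      ?V * ?z / (\<Sum>j = 1..d 1. \<bar>w1 j\<bar> * ?s j)"
    using assms(1) \<open>?V \<ge> 0\<close> x bound
    by (intro sum_signed_weight_rescaled signed_out_duplicate signed_out_eq) force+
  \<comment> \<open>The quotient cancels unless \<open>?V = 0\<close>, when it is 0 by convention;
    the bound of \<open>?z\<close> by \<open>?V\<close> then gives \<open>?z = 0\<close> as
    well.\<close>
  also have "\<dots> = ?z"
  proof -
    have "\<bar>?z\<bar> \<le> (\<Sum>j = 1..d 1. \<bar>w1 j * ?u j\<bar>)"
      by (rule sum_abs)
    also have "\<dots> \<le> ?V"
      unfolding V abs_mult using bound by (intro sum_mono mult_left_mono) auto
    finally show ?thesis
      using V by (cases "?V = 0") auto
  qed
  finally show "relu_network L d \<phi>out w1 w x =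
      signed_network L d \<phi>out ?a1 ?a (\<lambda>j. ?V * signed_input (d L) x j)"
    by (simp add: relu_network_def signed_network_def network_def)
qed

end
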